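(* Let $F_i$ denote the $i$-th Fibonacci number. Then for every positive integer $m$, $$F_{2m+1}=\sum_{(i,j)\in T}(-1)^{i+j}\binom{2m}{m-3i-2j}$$ and $$F_{2m}=\sum_{(i,j)\in T}(-1)^{i+j}\binom{2m-1}{m-3i-2j},$$ where $T=\{(i,j)\in\mathbb{Z}\times\mathbb{Z} : i-j=0\text{ or }1\}$.
   Context: Fibonacci numbers are normalized by $F_1=F_2=1$, $F_{i+2}=F_{i+1}+F_i$. Convention: $\binom{N}{p}=0$ if $p<0$ or $p>N$ (so only finitely many terms of each sum are nonzero). *)

theory Defs
  imports "HOL-Analysis.Infinite_Sum" "HOL-Number_Theory.Fib"
begin

definition binomial_int :: "nat \<Rightarrow> int \<Rightarrow> nat" where
  "binomial_int N p = (if p < 0 \<or> p > int N then 0 else N choose nat p)"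

definition T :: "(int \<times> int) set" where
  "T = {(i, j). i - j = 0 \<or> i - j = 1}"

text \<open>The sums over the infinite set \<^term>\<open>T\<close> are finitely supported, so \<^const>\<open>has_sum\<close>
  amounts to finite summation over the support.\<close>

lemma finite_support_T:
  "finite {(i, j) \<in> T. binomial_int N (k - 3 * i - 2 * j) \<noteq> 0}"
proof (rule finite_subset)
  show "{(i, j) \<in> T. binomial_int N (k - 3 * i - 2 * j) \<noteq> 0}
      \<subseteq> {- \<bar>k\<bar> - int N - 3..\<bar>k\<bar> + int N + 3} \<times> {- \<bar>k\<bar> - int N - 3..\<bar>k\<bar> + int N + 3}"
    by (auto simp: T_def binomial_int_def split: if_splits)
qed simp

end

(* Summing over T amounts to comparing the sums of the N-th binomial row over the residue classes
   r and r - 3 = r + 2 modulo 5. Write D N r for this difference. Pascal's rule gives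
   D (N + 1) r = D N r + D N (r - 1), and the symmetry p \<mapsto> N - p of the row makes
   D (2m + 1) m = D (2m) m and D (2m + 2) (m + 2) = D (2m + 1) (m + 1), because in each case the
   two extra residue classes are exchanged. These relations reproduce the Fibonacci recurrence. *)
theory Submission
  imports Defs
begin

text \<open>Extending the row by zero keeps Pascal's rule valid at every integer \<open>p\<close>,
  including both ends of the row, so no boundary terms appear when it is summed over a residue
  class.\<close>

lemma binomial_int_Suc:
  "binomial_int (Suc N) p = binomial_int N p + binomial_int N (p - 1)"
proof (cases "p \<le> 0")
  case True
  then show ?thesis by (auto simp: binomial_int_def)
next
  case False
  define k where "k = nat (p - 1)"
  have "p = int (Suc k)" using False by (simp add: k_def)
  then show ?thesis by (auto simp: binomial_int_def nat_add_distrib)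
qed

lemma binomial_int_symmetric: "binomial_int N (int N - p) = binomial_int N p"
proof (cases "0 \<le> p \<and> p \<le> int N")
  case True
  then obtain k where "p = int k" "k \<le> N" by (metis nat_0_le nat_le_iff)
  then show ?thesis by (simp add: binomial_int_def nat_diff_distrib binomial_symmetric[of k N])
qed (auto simp: binomial_int_def)

text \<open>Letting \<open>j\<close> run through all integers makes the value depend only on
  \<open>r\<close> modulo 5 and turns shifts and reflections of the row into reindexings by
  bijections.\<close>

definition binomial_class_sum :: "nat \<Rightarrow> int \<Rightarrow> real" where
  "binomial_class_sum N r = (\<Sum>\<^sub>\<infinity>j. real (binomial_int N (r - 5 * j)))"

lemma binomial_class_summable: "(\<lambda>j. real (binomial_int N (r - 5 * j))) summable_on UNIV"
proof (rule summable_on_cong_neutral[THEN iffD2])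
  \<comment> \<open>A nonzero term forces 0 \<le> r - 5 * j \<le> N, which confines \<open>j\<close>
    to this finite interval.\<close>
  let ?S = "{- \<bar>r\<bar> - int N..\<bar>r\<bar> + int N}"
  show "(\<lambda>j. real (binomial_int N (r - 5 * j))) summable_on ?S" by simp
qed (auto simp: binomial_int_def)

lemma has_sum_binomial_class_sum:
  "((\<lambda>j. real (binomial_int N (r - 5 * j))) has_sum binomial_class_sum N r) UNIV"
  unfolding binomial_class_sum_def by (rule has_sum_infsum[OF binomial_class_summable])

lemma binomial_class_sum_0:
  "binomial_class_sum 0 r = (if 5 dvd r then 1 else 0)"
proof -
  have "binomial_class_sum 0 r = infsum (\<lambda>j. real (binomial_int 0 (r - 5 * j))) {j. r = 5 * j}"
    unfolding binomial_class_sum_def by (rule infsum_cong_neutral) (auto simp: binomial_int_def)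
  also have "{j. r = 5 * j} = (if 5 dvd r then {r div 5} else {})"
    by auto
  finally show ?thesis by (auto simp: binomial_int_def)
qed

lemma binomial_class_sum_Suc:
  "binomial_class_sum (Suc N) r = binomial_class_sum N r + binomial_class_sum N (r - 1)"
proof -
  have "((\<lambda>j. real (binomial_int (Suc N) (r - 5 * j)))
      has_sum binomial_class_sum N r + binomial_class_sum N (r - 1)) UNIV"
    using has_sum_add[OF has_sum_binomial_class_sum[of N r] has_sum_binomial_class_sum[of N "r - 1"]]
    by (simp add: binomial_int_Suc algebra_simps)
  then show ?thesis
    using has_sum_binomial_class_sum has_sum_unique by blast
qed

lemma binomial_class_sum_periodic: "binomial_class_sum N (r + 5) = binomial_class_sum N r"
proof -
  have "bij (\<lambda>j::int. j - 1)"
    by (rule bij_betw_byWitness[where f' = "\<lambda>j. j + 1"]) auto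
  from infsum_reindex_bij_betw[OF this, of "\<lambda>j. real (binomial_int N (r - 5 * j))"]
  show ?thesis by (simp add: binomial_class_sum_def algebra_simps)
qed

text \<open>The reflection p \<mapsto> N - p of the row maps the class of \<open>r\<close> to that
  of \<open>N - r\<close>; on the summation index it is negation.\<close>

lemma binomial_class_sum_symmetric:
  "binomial_class_sum N (int N - r) = binomial_class_sum N r"
proof -
  have *: "binomial_int N (int N - r - 5 * j) = binomial_int N (r - 5 * - j)" for j
    using binomial_int_symmetric[of N "r - 5 * - j"] by (simp add: algebra_simps)
  have "bij (uminus :: int \<Rightarrow> int)"
    by (rule bij_betw_byWitness[where f' = uminus]) auto
  from infsum_reindex_bij_betw[OF this, of "\<lambda>j. real (binomial_int N (r - 5 * j))"]
  show ?thesis unfolding binomial_class_sum_def * .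
qed

text \<open>\<open>T\<close> consists of the two disjoint lines (j, j) and (j + 1, j). On the first
  the sign is 1 and 3 * i + 2 * j becomes 5 * j; on the second the sign is -1 and it becomes 5 * j +
  3.\<close>

lemma has_sum_T:
  "((\<lambda>(i, j). (-1 :: real) powi (i + j) * real (binomial_int N (r - 3 * i - 2 * j)))
     has_sum binomial_class_sum N r - binomial_class_sum N (r - 3)) T"
    (is "(?f has_sum _) T")
proof -
  let ?d = "\<lambda>j::int. (j, j)" and ?e = "\<lambda>j::int. (j + 1, j)"
  have sign: "(-1 :: real) powi (j + j) = 1" "(-1 :: real) powi (j + 1 + j) = - 1" for j :: int
    by (simp_all add: power_int_minus_left)
  have "?f \<circ> ?d = (\<lambda>j. real (binomial_int N (r - 5 * j)))"
    unfolding o_def prod.case sign by (simp add: algebra_simps)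
  then have d: "(?f has_sum binomial_class_sum N r) (range ?d)"
    by (subst has_sum_reindex) (simp_all add: inj_on_def has_sum_binomial_class_sum)
  have "?f \<circ> ?e = (\<lambda>j. - real (binomial_int N (r - 3 - 5 * j)))"
    unfolding o_def prod.case sign by (simp add: algebra_simps)
  then have e: "(?f has_sum - binomial_class_sum N (r - 3)) (range ?e)"
    by (subst has_sum_reindex)
      (simp_all add: inj_on_def has_sum_uminus has_sum_binomial_class_sum)
  have "T = range ?d \<union> range ?e" by (auto simp: T_def image_iff)
  moreover have "range ?d \<inter> range ?e = {}" by auto
  ultimately show ?thesis using has_sum_Un_disjoint[OF d e] by simp
qed

lemma binomial_class_sum_fib:
  fixes m :: nat
  defines "D \<equiv> \<lambda>N r. binomial_class_sum N r - binomial_class_sum N (r - 3)"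
  shows "D (2 * m) (int m) = fib (2 * m + 1)"
    and "D (2 * m + 1) (int m + 1) = fib (2 * m + 2)"
proof -
  have pascal: "D (Suc N) r = D N r + D N (r - 1)" for N r
    by (simp add: D_def binomial_class_sum_Suc algebra_simps)
  \<comment> \<open>Pascal's rule leaves the extra term \<open>D (2 * m) (m - 1)\<close>, the
    difference of the classes m - 1 and m - 4. Modulo 5 the latter is m + 1 = 2m - (m - 1), so the
    two sums agree.\<close>
  have even_row: "D (2 * m + 1) (int m) = D (2 * m) (int m)" for m
    using binomial_class_sum_periodic[of "2 * m" "int m - 4"]
      binomial_class_sum_symmetric[of "2 * m" "int m - 1"]
    by (simp add: D_def binomial_class_sum_Suc algebra_simps)
  \<comment> \<open>Here the extra term is \<open>D (2 * m + 1) (m + 2)\<close>, which compares m +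
    2 with m - 1. These add up to 2m + 1, so reflection makes it vanish.\<close>
  have odd_row: "D (2 * m + 2) (int m + 2) = D (2 * m + 1) (int m + 1)" for m
    using binomial_class_sum_periodic[of "2 * m + 1" "int m - 3"]
      binomial_class_sum_symmetric[of "2 * m + 1" "int m - 1"]
      binomial_class_sum_Suc[of "2 * m + 1"]
    by (simp add: D_def algebra_simps)
  \<comment> \<open>The value at m + 1 is carried along because Pascal's rule needs two neighbouring
    values: together they give \<open>fib (2 * m + 2)\<close> in row 2m + 1, from which both values
    in row 2m + 2 follow.\<close>
  have fib: "D (2 * m) (int m) = fib (2 * m + 1) \<and> D (2 * m) (int m + 1) = fib (2 * m)" for m
  proof (induction m)
    case 0
    show ?case by (simp add: D_def binomial_class_sum_0)
  next
    case (Suc m)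
    then have "D (2 * m + 1) (int m + 1) = fib (2 * m + 2)"
      using pascal[of "2 * m" "int m + 1"] by simp
    then show ?case
      using Suc even_row[of m] odd_row[of m] pascal[of "2 * m + 1" "int m + 1"]
      by (simp add: algebra_simps)
  qed
  then show "D (2 * m) (int m) = fib (2 * m + 1)" by blast
  show "D (2 * m + 1) (int m + 1) = fib (2 * m + 2)"
    using fib[of m] pascal[of "2 * m" "int m + 1"] by simp
qed

theorem corollary3p8:
  fixes m :: nat
  assumes "m > 0"
  shows "((\<lambda>(i, j). (-1 :: real) powi (i + j) * real (binomial_int (2 * m) (int m - 3 * i - 2 * j)))
            has_sum real (fib (2 * m + 1))) T
       \<and> ((\<lambda>(i, j). (-1 :: real) powi (i + j) * real (binomial_int (2 * m - 1) (int m - 3 * i - 2 * j)))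
            has_sum real (fib (2 * m))) T"
proof -
  \<comment> \<open>Row 2m - 1 is row 2k + 1 with k = m - 1, the form in which the odd-row value is
    available; this also removes the truncated subtraction.\<close>
  obtain k where k: "m = Suc k" using assms gr0_implies_Suc by blast
  have eqs: "2 * m - 1 = 2 * k + 1" "int m = int k + 1" "2 * m = 2 * k + 2"
    by (simp_all add: k)
  show ?thesis
  proof
    show "((\<lambda>(i, j). (-1 :: real) powi (i + j) * real (binomial_int (2 * m) (int m - 3 * i - 2 * j)))
        has_sum real (fib (2 * m + 1))) T"
      using has_sum_T[of "2 * m" "int m"] unfolding binomial_class_sum_fib(1) .
    show "((\<lambda>(i, j). (-1 :: real) powi (i + j) * real (binomial_int (2 * m - 1) (int m - 3 * i - 2 * j)))
        has_sum real (fib (2 * m))) T"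
      unfolding eqs(1) unfolding eqs(2,3) using has_sum_T[of "2 * k + 1" "int k + 1"]
      unfolding binomial_class_sum_fib(2) .
  qed
qed

end
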